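(* Let $\Gamma=(\pi,\mathcal{C},\Sigma)$ be a concrete data type definition, $\mathcal{E}$ a finite set of equations between terms of sort $\pi$ (possibly with variables), and $\mathcal{F}=(f_C)_{C\in\mathcal{C}}$ a family of construction functions that is valid with respect to $\mathcal{E}$. Then the normalization function $f$ associated to $\mathcal{F}$ is a valid normalization function for $(\Gamma,\mathcal{E})$, i.e. (correctness) $f(t)=_\mathcal{E} t$ for all $t\in\mathcal{T}_\pi$, and (completeness) $f(t)=f(u)$ for all $t,u\in\mathcal{T}_\pi$ with $t=_\mathcal{E}u$.
   Context: Fix a set $\mathcal{S}_0$ of primitive sorts and a set $\mathcal{C}_0$ of primitive constants, each having a sort in $\mathcal{S}_0$. A concrete data type definition is a triple $\Gamma=(\pi,\mathcal{C},\Sigma)$ where $\pi\notin\mathcal{S}_0$ is a sort, $\mathcal{C}$ is a non-empty set of constructor symbols, and $\Sigma$ assigns to every $C\in\mathcal{C}$ a sequence $\sigma_1\ldots\sigma_n\pi$ ($n\ge0$, each $\sigma_i\in\mathcal{S}_0\cup\{\pi\}$), written $C:\sigma_1\ldots\sigma_n\pi$. $\mathcal{T}_\sigma$ is the set of variable-free well-sorted terms of sort $\sigma$ over $\mathcal{C}_0\cup\mathcal{C}$; terms with sorted variables are also allowed in equations. $=_\mathcal{E}$ is the smallest congruence on terms containing $\mathcal{E}$ (closed under substitution instances, contexts, reflexivity, symmetry, transitivity). A family of construction functions is $\mathcal{F}=(f_C)_{C\in\mathcal{C}}$ with $f_C:\mathcal{T}_{\sigma_1}\times\cdots\times\mathcal{T}_{\sigma_n}\to\mathcal{T}_\pi$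 for $C:\sigma_1\ldots\sigma_n\pi$. Values: $\mathrm{Val}(\sigma)=\mathcal{T}_\sigma$ for $\sigma\in\mathcal{S}_0$, and $\mathrm{Val}(\pi)$ is the smallest set containing $f_C(v_1,\ldots,v_n)$ for every $C:\sigma_1\ldots\sigma_n\pi$ and $v_i\in\mathrm{Val}(\sigma_i)$. $\mathcal{F}$ is valid with respect to $\mathcal{E}$ if (correctness) for all $C:\sigma_1\ldots\sigma_n\pi$ and $v_i\in\mathrm{Val}(\sigma_i)$, $f_C(v_1,\ldots,v_n)=_\mathcal{E}C(v_1,\ldots,v_n)$; and (completeness) for all $C:\sigma_1\ldots\sigma_n\pi$, $v_i\in\mathrm{Val}(\sigma_i)$, $D:\tau_1\ldots\tau_p\pi$, $w_j\in\mathrm{Val}(\tau_j)$, if $C(v_1,\ldots,v_n)=_\mathcal{E}D(w_1,\ldots,w_p)$ then $f_C(v_1,\ldots,v_n)=f_D(w_1,\ldots,w_p)$ (syntactic equality). The normalization function associated to $\mathcal{F}$ is $f:\mathcal{T}_\pi\to\mathcal{T}_\pi$ defined recursively by $f(C(t_1,\ldots,t_n))=f_C(f(t_1),\ldots,f(t_n))$, with $f$ acting as the identity on arguments of primitive sort. *)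

theory Defs
  imports Main
begin

text \<open>
  Constants and constructors live in different types, so the primitive constants and the
  constructor symbols are disjoint by construction.  A variable carries its sort.
\<close>

datatype ('s, 'k, 'c, 'v) trm =
    Var 's 'v
  | Const 'k
  | Con 'c "('s, 'k, 'c, 'v) trm list"

primrec vars :: "('s, 'k, 'c, 'v) trm \<Rightarrow> ('s \<times> 'v) set" where
  "vars (Var s x) = {(s, x)}"
| "vars (Const k) = {}"
| "vars (Con c ts) = \<Union> (set (map vars ts))"

primrec subst :: "('s \<Rightarrow> 'v \<Rightarrow> ('s, 'k, 'c, 'v) trm) \<Rightarrow> ('s, 'k, 'c, 'v) trm \<Rightarrow> ('s, 'k, 'c, 'v) trm" where
  "subst \<theta> (Var s x) = \<theta> s x"
| "subst \<theta> (Const k) = Const k"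
| "subst \<theta> (Con c ts) = Con c (map (subst \<theta>) ts)"

text \<open>
  The record bundles a data type definition with the primitive sorts and constants it is built
  on.  The result sort of a constructor is always \<open>dsort\<close>, so only its argument sorts
  are recorded.  The functions \<open>const_sort\<close> and \<open>arg_sorts\<close> are only relevant on
  \<open>prim_consts\<close> and \<open>constrs\<close>.
\<close>

record ('s, 'k, 'c) data_def =
  prim_sorts :: "'s set"
  prim_consts :: "'k set"
  const_sort :: "'k \<Rightarrow> 's"
  dsort :: 's
  constrs :: "'c set"
  arg_sorts :: "'c \<Rightarrow> 's list"

definition all_sorts :: "('s, 'k, 'c) data_def \<Rightarrow> 's set" where
  "all_sorts \<Gamma> = insert (dsort \<Gamma>) (prim_sorts \<Gamma>)"

definition concrete_data_type :: "('s, 'k, 'c) data_def \<Rightarrow> bool" where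
  "concrete_data_type \<Gamma> \<longleftrightarrow>
     (\<forall>k\<in>prim_consts \<Gamma>. const_sort \<Gamma> k \<in> prim_sorts \<Gamma>) \<and>
     dsort \<Gamma> \<notin> prim_sorts \<Gamma> \<and>
     constrs \<Gamma> \<noteq> {} \<and>
     (\<forall>c\<in>constrs \<Gamma>. set (arg_sorts \<Gamma> c) \<subseteq> all_sorts \<Gamma>)"

inductive has_sort :: "('s, 'k, 'c) data_def \<Rightarrow> ('s, 'k, 'c, 'v) trm \<Rightarrow> 's \<Rightarrow> bool"
  for \<Gamma> :: "('s, 'k, 'c) data_def" where
  Var: "s \<in> all_sorts \<Gamma> \<Longrightarrow> has_sort \<Gamma> (Var s x) s"
| Const: "k \<in> prim_consts \<Gamma> \<Longrightarrow> has_sort \<Gamma> (Const k) (const_sort \<Gamma> k)"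
| Con: "c \<in> constrs \<Gamma> \<Longrightarrow> list_all2 (has_sort \<Gamma>) ts (arg_sorts \<Gamma> c)
          \<Longrightarrow> has_sort \<Gamma> (Con c ts) (dsort \<Gamma>)"

definition gterms :: "('s, 'k, 'c) data_def \<Rightarrow> 's \<Rightarrow> ('s, 'k, 'c, 'v) trm set" where
  "gterms \<Gamma> s = {t. has_sort \<Gamma> t s \<and> vars t = {}}"

definition equations :: "('s, 'k, 'c) data_def
    \<Rightarrow> (('s, 'k, 'c, 'v) trm \<times> ('s, 'k, 'c, 'v) trm) set \<Rightarrow> bool" where
  "equations \<Gamma> E \<longleftrightarrow>
     (\<forall>(l, r)\<in>E. has_sort \<Gamma> l (dsort \<Gamma>) \<and> has_sort \<Gamma> r (dsort \<Gamma>))"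

definition sorted_subst ::
    "('s, 'k, 'c) data_def \<Rightarrow> ('s \<Rightarrow> 'v \<Rightarrow> ('s, 'k, 'c, 'v) trm) \<Rightarrow> bool" where
  "sorted_subst \<Gamma> \<theta> \<longleftrightarrow> (\<forall>s\<in>all_sorts \<Gamma>. \<forall>x. has_sort \<Gamma> (\<theta> s x) s)"

inductive eq_mod :: "('s, 'k, 'c) data_def
    \<Rightarrow> (('s, 'k, 'c, 'v) trm \<times> ('s, 'k, 'c, 'v) trm) set
    \<Rightarrow> ('s, 'k, 'c, 'v) trm \<Rightarrow> ('s, 'k, 'c, 'v) trm \<Rightarrow> bool"
  for \<Gamma> :: "('s, 'k, 'c) data_def" and E where
  ax: "(t, u) \<in> E \<Longrightarrow> eq_mod \<Gamma> E t u"
| inst: "eq_mod \<Gamma> E t u \<Longrightarrow> sorted_subst \<Gamma> \<theta> \<Longrightarrow> eq_mod \<Gamma> E (subst \<theta> t) (subst \<theta> u)"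
| ctxt: "has_sort \<Gamma> (Con c ts) (dsort \<Gamma>) \<Longrightarrow> has_sort \<Gamma> (Con c us) (dsort \<Gamma>)
          \<Longrightarrow> list_all2 (eq_mod \<Gamma> E) ts us \<Longrightarrow> eq_mod \<Gamma> E (Con c ts) (Con c us)"
| refl: "has_sort \<Gamma> t s \<Longrightarrow> eq_mod \<Gamma> E t t"
| sym: "eq_mod \<Gamma> E t u \<Longrightarrow> eq_mod \<Gamma> E u t"
| trans: "eq_mod \<Gamma> E t u \<Longrightarrow> eq_mod \<Gamma> E u v \<Longrightarrow> eq_mod \<Gamma> E t v"

definition construction_functions :: "('s, 'k, 'c) data_def
    \<Rightarrow> ('c \<Rightarrow> ('s, 'k, 'c, 'v) trm list \<Rightarrow> ('s, 'k, 'c, 'v) trm) \<Rightarrow> bool" where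
  "construction_functions \<Gamma> F \<longleftrightarrow>
     (\<forall>c\<in>constrs \<Gamma>. \<forall>ts. list_all2 (\<lambda>t s. t \<in> gterms \<Gamma> s) ts (arg_sorts \<Gamma> c)
        \<longrightarrow> F c ts \<in> gterms \<Gamma> (dsort \<Gamma>))"

inductive is_val :: "('s, 'k, 'c) data_def
    \<Rightarrow> ('c \<Rightarrow> ('s, 'k, 'c, 'v) trm list \<Rightarrow> ('s, 'k, 'c, 'v) trm)
    \<Rightarrow> ('s, 'k, 'c, 'v) trm \<Rightarrow> 's \<Rightarrow> bool"
  for \<Gamma> :: "('s, 'k, 'c) data_def" and F where
  prim: "s \<in> prim_sorts \<Gamma> \<Longrightarrow> t \<in> gterms \<Gamma> s \<Longrightarrow> is_val \<Gamma> F t s"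
| con: "c \<in> constrs \<Gamma> \<Longrightarrow> list_all2 (is_val \<Gamma> F) vs (arg_sorts \<Gamma> c)
          \<Longrightarrow> is_val \<Gamma> F (F c vs) (dsort \<Gamma>)"

definition valid_construction :: "('s, 'k, 'c) data_def
    \<Rightarrow> (('s, 'k, 'c, 'v) trm \<times> ('s, 'k, 'c, 'v) trm) set
    \<Rightarrow> ('c \<Rightarrow> ('s, 'k, 'c, 'v) trm list \<Rightarrow> ('s, 'k, 'c, 'v) trm) \<Rightarrow> bool" where
  "valid_construction \<Gamma> E F \<longleftrightarrow>
     (\<forall>c\<in>constrs \<Gamma>. \<forall>vs. list_all2 (is_val \<Gamma> F) vs (arg_sorts \<Gamma> c)
        \<longrightarrow> eq_mod \<Gamma> E (F c vs) (Con c vs)) \<and>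
     (\<forall>c\<in>constrs \<Gamma>. \<forall>vs. list_all2 (is_val \<Gamma> F) vs (arg_sorts \<Gamma> c) \<longrightarrow>
        (\<forall>d\<in>constrs \<Gamma>. \<forall>ws. list_all2 (is_val \<Gamma> F) ws (arg_sorts \<Gamma> d) \<longrightarrow>
           eq_mod \<Gamma> E (Con c vs) (Con d ws) \<longrightarrow> F c vs = F d ws))"

text \<open>
  The identity on arguments of primitive sort is the equation for \<open>Const\<close>, because the
  variable-free terms of primitive sort are exactly constants (lemma below).  The equation for
  \<open>Var\<close> only makes the function total; it is never used on variable-free terms.
\<close>

primrec normal_fun :: "('c \<Rightarrow> ('s, 'k, 'c, 'v) trm list \<Rightarrow> ('s, 'k, 'c, 'v) trm)
    \<Rightarrow> ('s, 'k, 'c, 'v) trm \<Rightarrow> ('s, 'k, 'c, 'v) trm" where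
  "normal_fun F (Var s x) = Var s x"
| "normal_fun F (Const k) = Const k"
| "normal_fun F (Con c ts) = F c (map (normal_fun F) ts)"

lemma gterms_prim:
  assumes "concrete_data_type \<Gamma>" "s \<in> prim_sorts \<Gamma>"
  shows "gterms \<Gamma> s = Const ` {k \<in> prim_consts \<Gamma>. const_sort \<Gamma> k = s}"
  using assms
  by (auto simp: gterms_def concrete_data_type_def intro: has_sort.Const elim: has_sort.cases)

definition valid_normalization :: "('s, 'k, 'c) data_def
    \<Rightarrow> (('s, 'k, 'c, 'v) trm \<times> ('s, 'k, 'c, 'v) trm) set
    \<Rightarrow> (('s, 'k, 'c, 'v) trm \<Rightarrow> ('s, 'k, 'c, 'v) trm) \<Rightarrow> bool" where
  "valid_normalization \<Gamma> E f \<longleftrightarrow>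
     (\<forall>t\<in>gterms \<Gamma> (dsort \<Gamma>). f t \<in> gterms \<Gamma> (dsort \<Gamma>)) \<and>
     (\<forall>t\<in>gterms \<Gamma> (dsort \<Gamma>). eq_mod \<Gamma> E (f t) t) \<and>
     (\<forall>t\<in>gterms \<Gamma> (dsort \<Gamma>). \<forall>u\<in>gterms \<Gamma> (dsort \<Gamma>). eq_mod \<Gamma> E t u \<longrightarrow> f t = f u)"

end

theory Submission
  imports Defs
begin

text \<open>
  The normal form of \<open>Con c ts\<close> is \<open>F c vs\<close> for values \<open>vs\<close> congruent to
  \<open>ts\<close>, so correctness of the construction functions lifts to the normalization function
  by induction.  If two terms are congruent, then so are \<open>Con c vs\<close> and
  \<open>Con d ws\<close> for the corresponding values, and completeness of the construction
  functions identifies the two normal forms.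
\<close>

text \<open>The three claims need a simultaneous induction: correctness of \<open>F\<close> is
  available only on arguments that are values, and \<open>construction_functions\<close> only on
  ground well-sorted ones. The sort \<open>s\<close> is arbitrary because constructor arguments may
  have primitive sort; on those the constants are fixed and are values by
  \<open>is_val.prim\<close>.\<close>

lemma normal_fun_value:
  assumes "concrete_data_type \<Gamma>" "construction_functions \<Gamma> F" "valid_construction \<Gamma> E F"
    and "has_sort \<Gamma> t s" "vars t = {}"
  shows "is_val \<Gamma> F (normal_fun F t) s \<and> normal_fun F t \<in> gterms \<Gamma> s
    \<and> eq_mod \<Gamma> E (normal_fun F t) t"
  using assms(4,5)
proof (induction rule: has_sort.induct)
  case (Var s x)
  then show ?case by simp
next
  case (Const k)
  have "has_sort \<Gamma> (Const k) (const_sort \<Gamma> k)"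
    using Const.hyps by (rule has_sort.Const)
  moreover have "const_sort \<Gamma> k \<in> prim_sorts \<Gamma>"
    using assms(1) Const by (simp add: concrete_data_type_def)
  ultimately show ?case
    by (auto simp: gterms_def intro: is_val.prim eq_mod.refl)
next
  case (Con c ts)
  let ?vs = "map (normal_fun F) ts"
  have len: "length ts = length (arg_sorts \<Gamma> c)"
    using Con.IH by (simp add: list_all2_lengthD)
  have args: "has_sort \<Gamma> (ts ! i) (arg_sorts \<Gamma> c ! i)
      \<and> is_val \<Gamma> F (normal_fun F (ts ! i)) (arg_sorts \<Gamma> c ! i)
      \<and> normal_fun F (ts ! i) \<in> gterms \<Gamma> (arg_sorts \<Gamma> c ! i)
      \<and> eq_mod \<Gamma> E (normal_fun F (ts ! i)) (ts ! i)" if "i < length ts" for i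
  proof -
    have "vars (ts ! i) = {}"
      using Con.prems that by simp
    then show ?thesis
      using list_all2_nthD[OF Con.IH that] by simp
  qed
  have vals: "list_all2 (is_val \<Gamma> F) ?vs (arg_sorts \<Gamma> c)"
    using len args by (simp add: list_all2_conv_all_nth)
  have ground: "list_all2 (\<lambda>t s. t \<in> gterms \<Gamma> s) ?vs (arg_sorts \<Gamma> c)"
    using len args by (simp add: list_all2_conv_all_nth)
  \<comment> \<open>\<open>eq_mod.ctxt\<close> demands that both sides be well-sorted, so the sorts
    of the normalized arguments are needed as well.\<close>
  have "list_all2 (has_sort \<Gamma>) ts (arg_sorts \<Gamma> c)"
    "list_all2 (has_sort \<Gamma>) ?vs (arg_sorts \<Gamma> c)"
    using len args by (simp_all add: list_all2_conv_all_nth gterms_def)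
  then have "has_sort \<Gamma> (Con c ts) (dsort \<Gamma>)" "has_sort \<Gamma> (Con c ?vs) (dsort \<Gamma>)"
    using Con.hyps by (auto intro: has_sort.Con)
  moreover have "list_all2 (eq_mod \<Gamma> E) ?vs ts"
    using args by (simp add: list_all2_conv_all_nth)
  ultimately have "eq_mod \<Gamma> E (Con c ?vs) (Con c ts)"
    by (intro eq_mod.ctxt)
  moreover have "eq_mod \<Gamma> E (F c ?vs) (Con c ?vs)"
    using assms(3) Con.hyps vals by (auto simp: valid_construction_def)
  ultimately have "eq_mod \<Gamma> E (F c ?vs) (Con c ts)"
    by (blast intro: eq_mod.trans)
  moreover have "is_val \<Gamma> F (F c ?vs) (dsort \<Gamma>)"
    using Con.hyps vals by (intro is_val.con)
  moreover have "F c ?vs \<in> gterms \<Gamma> (dsort \<Gamma>)"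
    using assms(2) Con.hyps ground by (auto simp: construction_functions_def)
  ultimately show ?case by simp
qed

text \<open>Rule \<open>prim\<close> is ruled out because \<open>dsort \<Gamma>\<close> is not a
  primitive sort.\<close>

lemma is_val_dsort_cases:
  assumes "concrete_data_type \<Gamma>" "is_val \<Gamma> F t (dsort \<Gamma>)"
  obtains c vs where "c \<in> constrs \<Gamma>" "list_all2 (is_val \<Gamma> F) vs (arg_sorts \<Gamma> c)" "t = F c vs"
  using assms(2)
proof cases
  case prim
  then show ?thesis using assms(1) by (simp add: concrete_data_type_def)
next
  case con
  then show ?thesis using that by blast
qed

text \<open>Each congruence class contains at most one value of sort \<open>dsort \<Gamma>\<close>.
  Any presentation \<open>F c vs\<close> of a value will do, since correctness makes it congruent to
  \<open>Con c vs\<close>, and completeness compares such terms.\<close>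

lemma eq_mod_values_eq:
  assumes "concrete_data_type \<Gamma>" "valid_construction \<Gamma> E F"
    and "is_val \<Gamma> F t (dsort \<Gamma>)" "is_val \<Gamma> F u (dsort \<Gamma>)" "eq_mod \<Gamma> E t u"
  shows "t = u"
proof -
  obtain c vs where c: "c \<in> constrs \<Gamma>" "list_all2 (is_val \<Gamma> F) vs (arg_sorts \<Gamma> c)" "t = F c vs"
    using assms(1,3) by (rule is_val_dsort_cases)
  obtain d ws where d: "d \<in> constrs \<Gamma>" "list_all2 (is_val \<Gamma> F) ws (arg_sorts \<Gamma> d)" "u = F d ws"
    using assms(1,4) by (rule is_val_dsort_cases)
  have "eq_mod \<Gamma> E t (Con c vs)" "eq_mod \<Gamma> E u (Con d ws)"
    using assms(2) c d by (auto simp: valid_construction_def)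
  then have "eq_mod \<Gamma> E (Con c vs) (Con d ws)"
    using assms(5) by (blast intro: eq_mod.sym eq_mod.trans)
  then show ?thesis
    using assms(2) c d unfolding valid_construction_def by blast
qed

theorem theorem1:
  fixes \<Gamma> :: "('s, 'k, 'c) data_def"
    and E :: "(('s, 'k, 'c, 'v) trm \<times> ('s, 'k, 'c, 'v) trm) set"
    and F :: "'c \<Rightarrow> ('s, 'k, 'c, 'v) trm list \<Rightarrow> ('s, 'k, 'c, 'v) trm"
  assumes "concrete_data_type \<Gamma>"
    and "finite E"
    and "equations \<Gamma> E"
    and "construction_functions \<Gamma> F"
    and "valid_construction \<Gamma> E F"
  shows "valid_normalization \<Gamma> E (normal_fun F)"
proof -
  have norm: "is_val \<Gamma> F (normal_fun F t) (dsort \<Gamma>)"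
    "normal_fun F t \<in> gterms \<Gamma> (dsort \<Gamma>)"
    "eq_mod \<Gamma> E (normal_fun F t) t" if "t \<in> gterms \<Gamma> (dsort \<Gamma>)" for t
    using normal_fun_value[OF assms(1,4,5), of t "dsort \<Gamma>"] that by (auto simp: gterms_def)
  have "normal_fun F t = normal_fun F u"
    if t: "t \<in> gterms \<Gamma> (dsort \<Gamma>)" and u: "u \<in> gterms \<Gamma> (dsort \<Gamma>)" and "eq_mod \<Gamma> E t u" for t u
  proof -
    \<comment> \<open>The chain runs from \<open>normal_fun F t\<close> through \<open>t\<close> and
      \<open>u\<close> to \<open>normal_fun F u\<close>; both ends are values, so uniqueness of
      values applies.\<close>
    have "eq_mod \<Gamma> E (normal_fun F t) (normal_fun F u)"
      using norm(3)[OF t] norm(3)[OF u] \<open>eq_mod \<Gamma> E t u\<close>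
      by (blast intro: eq_mod.sym eq_mod.trans)
    then show ?thesis
      using eq_mod_values_eq[OF assms(1,5) norm(1)[OF t] norm(1)[OF u]] by simp
  qed
  then show ?thesis
    using norm by (auto simp: valid_normalization_def)
qed

end
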